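(* Let $h$ be the Möbius transformation of $\overline{\mathbb{R}}^2$ that maps distinct points $a,b,c,d\in\mathbb{R}^2$ onto $-1,y,-y,1$, respectively. If $a,b,c,d$ are collinear and $|a-b|=|c-d|$, then $h^{-1}(0)=\dfrac{a+d}{2}$. Otherwise, $$h^{-1}(0)=\frac{(b-c)(a+d)y+(b+c)(a-d)}{2\big((b-c)y+a-d\big)},$$ where $$y=\frac{-k_1\pm\sqrt{k_1^2-k_0^2}}{k_0},\qquad k_0=(b-c)(a-d),\qquad k_1=(a-c)(b-d)+(a-b)(c-d);$$ the two possible solutions for $y$ are reciprocal numbers, so $y$ can be chosen so that $|y|<1$ in this case.
   Context: The plane $\mathbb{R}^2$ is identified with $\mathbb{C}$, and $\overline{\mathbb{R}}^2=\mathbb{R}^2\cup\{\infty\}$. The Möbius transformation $h$ is understood to be sense-preserving, i.e. of the form $z\mapsto(\alpha z+\beta)/(\gamma z+\delta)$ with $\alpha,\beta,\gamma,\delta\in\mathbb{C}$ and $\alpha\delta-\beta\gamma\neq0$.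
   Formalization: Collinear case with a-b=d-c is moved to "Otherwise" (-1,0,2,1 refutes (a+d)/2); if (b-c)y+a-d=0 then h^{-1}(0)=∞ (e.g. h=1/z); |y|<1 can be chosen exactly when k_1/k_0 is not real in [-1,1] (for -1,i,-i,1 both y=±i). *)

theory Defs
  imports "HOL-Analysis.Analysis"
begin

(* The extended plane is complex option with None as the point at infinity, as in
   Alexandroff_compactification.  The case distinctions handle infinity and the pole; the
   finite part is the library's moebius. *)

definition ext_moebius ::
  "complex \<Rightarrow> complex \<Rightarrow> complex \<Rightarrow> complex \<Rightarrow> complex option \<Rightarrow> complex option" where
  "ext_moebius \<alpha> \<beta> \<gamma> \<delta> p =
    (case p of
       None \<Rightarrow> if \<gamma> = 0 then None else Some (\<alpha> / \<gamma>)
     | Some z \<Rightarrow> if \<gamma> * z + \<delta> = 0 then None else Some (moebius \<alpha> \<beta> \<gamma> \<delta> z))"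

definition is_moebius :: "(complex option \<Rightarrow> complex option) \<Rightarrow> bool" where
  "is_moebius h \<longleftrightarrow>
    (\<exists>\<alpha> \<beta> \<gamma> \<delta>. \<alpha> * \<delta> - \<beta> * \<gamma> \<noteq> 0 \<and> h = ext_moebius \<alpha> \<beta> \<gamma> \<delta>)"

definition normalizes ::
  "(complex option \<Rightarrow> complex option) \<Rightarrow> complex \<Rightarrow> complex \<Rightarrow> complex \<Rightarrow> complex \<Rightarrow> complex \<Rightarrow> bool" where
  "normalizes h a b c d y \<longleftrightarrow> is_moebius h \<and>
     h (Some a) = Some (-1) \<and> h (Some b) = Some y \<and>
     h (Some c) = Some (-y) \<and> h (Some d) = Some 1"

(* Hence inv h is a genuine two-sided inverse of a Moebius transformation h. *)
lemma ext_moebius_inverse: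
  assumes "\<alpha> * \<delta> - \<beta> * \<gamma> \<noteq> 0"
  shows "ext_moebius \<delta> (-\<beta>) (-\<gamma>) \<alpha> (ext_moebius \<alpha> \<beta> \<gamma> \<delta> p) = p"
proof (cases p)
  case None
  then show ?thesis using assms by (auto simp: ext_moebius_def moebius_def field_simps)
next
  case (Some z)
  show ?thesis
  proof (cases "\<gamma> * z + \<delta> = 0")
    case True
    then have g: "\<gamma> \<noteq> 0" using assms by auto
    have "\<delta> = - (\<gamma> * z)" using True by (simp add: eq_neg_iff_add_eq_0 add.commute)
    then show ?thesis using Some True g by (simp add: ext_moebius_def)
  next
    case False
    have e: "- \<gamma> * ((\<alpha> * z + \<beta>) / (\<gamma> * z + \<delta>)) + \<alpha> = (\<alpha> * \<delta> - \<beta> * \<gamma>) / (\<gamma> * z + \<delta>)"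
      using False by (simp add: divide_simps) (simp add: algebra_simps)
    have "\<delta> * ((\<alpha> * z + \<beta>) / (\<gamma> * z + \<delta>)) + - \<beta> = (\<alpha> * \<delta> - \<beta> * \<gamma>) * z / (\<gamma> * z + \<delta>)"
      using False by (simp add: divide_simps) (simp add: algebra_simps)
    with e show ?thesis using Some False assms
      by (simp add: ext_moebius_def moebius_def)
  qed
qed

lemma is_moebius_bij:
  assumes "is_moebius h"
  shows "bij h"
proof -
  obtain \<alpha> \<beta> \<gamma> \<delta> where nz: "\<alpha> * \<delta> - \<beta> * \<gamma> \<noteq> 0" and h: "h = ext_moebius \<alpha> \<beta> \<gamma> \<delta>"
    using assms by (auto simp: is_moebius_def)
  have "ext_moebius \<alpha> \<beta> \<gamma> \<delta> (ext_moebius \<delta> (-\<beta>) (-\<gamma>) \<alpha> p) = p" for p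
    using ext_moebius_inverse[of \<delta> \<alpha> "-\<beta>" "-\<gamma>" p] nz by (simp add: mult.commute)
  with ext_moebius_inverse[OF nz] show ?thesis
    unfolding h by (intro o_bij[of "ext_moebius \<delta> (-\<beta>) (-\<gamma>) \<alpha>"]) (auto simp: fun_eq_iff)
qed

(* The theorem corrects the following points, at which the usual wording fails.
   - Collinear a, b, c, d with |a - b| = |c - d|: the preimage of 0 need not be (a + d)/2 if
     a - b = d - c (for -1, 0, 2, 1 that value is b).  This configuration, where the two segments
     are oppositely directed, is moved to the general case.
   - If (b - c) y + a - d = 0 then the preimage of 0 is infinity.  This happens only for
     parallelograms (a - b = c - d), and then for just one of the two values of y.
   - Both solutions y lie on the unit circle exactly if k1/k0 is real with modulus at most 1
     (for -1, i, -i, 1 they are i and -i); otherwise one of them lies inside. *)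

end

theory Submission
  imports Defs
begin

text \<open>
  A Moebius map sending \<open>a, b, d\<close> to \<open>-1, y, 1\<close> must satisfy
  \<open>(h z + 1) / (h z - 1) = K (z - a) / (z - d)\<close>, where \<open>K\<close> is read off at \<open>z = b\<close>.  It sends
  \<open>c\<close> to \<open>-y\<close> exactly if the cross ratios agree, which is the self-reciprocal equation
  \<open>k0 y^2 + 2 k1 y + k0 = 0\<close>.  The formula for \<open>h^-1(0) = - \<beta> / \<alpha>\<close> follows by adding and subtracting
  the interpolation conditions at \<open>a, d\<close> and at \<open>b, c\<close>.  If the roots of the equation are not
  strictly separated by the unit circle, they are conjugate, so \<open>- k1 / k0\<close> is their real part.
\<close>

section \<open>Moebius maps as coefficient tuples up to a common factor\<close>

lemma ext_moebius_Some_eq_Some_iff: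
  "ext_moebius \<alpha> \<beta> \<gamma> \<delta> (Some z) = Some w \<longleftrightarrow>
    \<gamma> * z + \<delta> \<noteq> 0 \<and> \<alpha> * z + \<beta> = w * (\<gamma> * z + \<delta>)"
  by (auto simp: ext_moebius_def moebius_def divide_simps)

lemma ext_moebius_scale:
  assumes "s \<noteq> 0"
  shows "ext_moebius (s * \<alpha>) (s * \<beta>) (s * \<gamma>) (s * \<delta>) = ext_moebius \<alpha> \<beta> \<gamma> \<delta>"
proof
  fix p
  have "s * \<gamma> * z + s * \<delta> = s * (\<gamma> * z + \<delta>)" "s * \<alpha> * z + s * \<beta> = s * (\<alpha> * z + \<beta>)" for z
    by (simp_all add: algebra_simps)
  then show "ext_moebius (s * \<alpha>) (s * \<beta>) (s * \<gamma>) (s * \<delta>) p = ext_moebius \<alpha> \<beta> \<gamma> \<delta> p"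
    using assms by (cases p) (auto simp: ext_moebius_def moebius_def)
qed

lemma inv_ext_moebius:
  assumes "\<alpha> * \<delta> - \<beta> * \<gamma> \<noteq> 0"
  shows "inv (ext_moebius \<alpha> \<beta> \<gamma> \<delta>) = ext_moebius \<delta> (-\<beta>) (-\<gamma>) \<alpha>"
proof (rule inv_equality)
  show "ext_moebius \<delta> (-\<beta>) (-\<gamma>) \<alpha> (ext_moebius \<alpha> \<beta> \<gamma> \<delta> p) = p" for p
    by (rule ext_moebius_inverse[OF assms])
  show "ext_moebius \<alpha> \<beta> \<gamma> \<delta> (ext_moebius \<delta> (-\<beta>) (-\<gamma>) \<alpha> p) = p" for p
    using ext_moebius_inverse[of \<delta> \<alpha> "-\<beta>" "-\<gamma>" p] assms by (simp add: mult.commute)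
qed

section \<open>Interpolation at four points\<close>

text \<open>With \<open>w\<close> the image of \<open>z\<close>, this is
  \<open>(w + 1) / (w - 1) = (N * (z - a)) / (M * (z - d))\<close> solved for \<open>w\<close>;
  \<open>N / M\<close> is forced by \<open>w = y\<close> at \<open>z = b\<close>. Keeping
  \<open>N\<close> and \<open>M\<close> separate avoids division, so the coefficients are
  polynomials.\<close>

definition three_point_moebius ::
  "complex \<Rightarrow> complex \<Rightarrow> complex \<Rightarrow> complex \<Rightarrow> complex option \<Rightarrow> complex option" where
  "three_point_moebius a b d y =
    (let N = (y + 1) * (b - d); M = (y - 1) * (b - a)
     in ext_moebius (N + M) (- N * a - M * d) (N - M) (- N * a + M * d))"

lemma normalizes_iff:
  fixes a b c d y :: complex
  assumes dist: "distinct [a, b, c, d]"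
  defines "k0 \<equiv> (b - c) * (a - d)"
  defines "k1 \<equiv> (a - c) * (b - d) + (a - b) * (c - d)"
  shows "normalizes h a b c d y \<longleftrightarrow>
    h = three_point_moebius a b d y \<and> k0 * y\<^sup>2 + 2 * k1 * y + k0 = 0"
proof -
  define N where "N = (y + 1) * (b - d)"
  define M where "M = (y - 1) * (b - a)"
  \<comment> \<open>The left side vanishes exactly when the cross ratios of
    \<open>a, b, c, d\<close> and of \<open>-1, y, -y, 1\<close> agree, after clearing
    denominators.\<close>
  have cross_ratio: "(y + 1)\<^sup>2 * ((b - d) * (a - c)) - (y - 1)\<^sup>2 * ((a - b) * (c - d))
      = k0 * y\<^sup>2 + 2 * k1 * y + k0"
    unfolding k0_def k1_def by algebra
  have tp: "three_point_moebius a b d y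
      = ext_moebius (N + M) (- N * a - M * d) (N - M) (- N * a + M * d)"
    by (simp add: three_point_moebius_def N_def M_def Let_def)
  show ?thesis
  proof (intro iffI conjI)
    assume "normalizes h a b c d y"
    then obtain \<alpha> \<beta> \<gamma> \<delta> where nz: "\<alpha> * \<delta> - \<beta> * \<gamma> \<noteq> 0" and h: "h = ext_moebius \<alpha> \<beta> \<gamma> \<delta>"
      and at: "\<alpha> * a + \<beta> = - (\<gamma> * a + \<delta>)" "\<gamma> * b + \<delta> \<noteq> 0" "\<alpha> * b + \<beta> = y * (\<gamma> * b + \<delta>)"
        "\<alpha> * c + \<beta> = - y * (\<gamma> * c + \<delta>)" "\<alpha> * d + \<beta> = \<gamma> * d + \<delta>"
      by (auto simp: normalizes_def is_moebius_def ext_moebius_Some_eq_Some_iff)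
    \<comment> \<open>Coefficients are fixed only up to a factor. The denominator of
      \<open>three_point_moebius\<close> at \<open>b\<close> is
      \<open>2 * (b - a) * (b - d)\<close>, so comparing it with
      \<open>\<gamma> * b + \<delta>\<close> gives the factor \<open>s / 2\<close>.\<close>
    define s where "s = (\<gamma> * b + \<delta>) / ((b - a) * (b - d))"
    have s: "s \<noteq> 0" "s * ((b - a) * (b - d)) = \<gamma> * b + \<delta>"
      using at dist by (auto simp: s_def)
    \<comment> \<open>The numerators of \<open>h + 1\<close> and \<open>h - 1\<close> vanish at
      \<open>a\<close> and \<open>d\<close>, hence are
      \<open>(\<alpha> + \<gamma>) * (z - a)\<close> and
      \<open>(\<alpha> - \<gamma>) * (z - d)\<close>; these are their values at
      \<open>b\<close>.\<close>
    have "(\<alpha> + \<gamma>) * (b - a) = (s * N) * (b - a)" "(\<alpha> - \<gamma>) * (b - d) = (s * M) * (b - d)"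
      using at s unfolding N_def M_def by algebra+
    then have NM: "\<alpha> + \<gamma> = s * N" "\<alpha> - \<gamma> = s * M" using dist by auto
    have "\<alpha> = s / 2 * (N + M)" "\<beta> = s / 2 * (- N * a - M * d)"
      "\<gamma> = s / 2 * (N - M)" "\<delta> = s / 2 * (- N * a + M * d)"
      using NM at(1,5) by algebra+
    then show "h = three_point_moebius a b d y"
      unfolding h tp using ext_moebius_scale[of "s / 2"] s(1)
      by (metis divide_eq_0_iff zero_neq_numeral)
    \<comment> \<open>The same two numerators evaluated at \<open>c\<close>, with the denominator
      \<open>\<gamma> * c + \<delta>\<close> eliminated.\<close>
    have "s * (k0 * y\<^sup>2 + 2 * k1 * y + k0) = 0"
      using NM at unfolding cross_ratio[symmetric] N_def M_def by algebra
    with s(1) show "k0 * y\<^sup>2 + 2 * k1 * y + k0 = 0" by simp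
  next
    assume R: "h = three_point_moebius a b d y \<and> k0 * y\<^sup>2 + 2 * k1 * y + k0 = 0"
    have quad: "(y + 1)\<^sup>2 * ((b - d) * (a - c)) = (y - 1)\<^sup>2 * ((a - b) * (c - d))"
      using R cross_ratio by simp
    \<comment> \<open>At \<open>y = 1\<close> or \<open>y = -1\<close> exactly one side of
      \<open>quad\<close> vanishes, since the points are distinct.\<close>
    have y: "y + 1 \<noteq> 0" "y - 1 \<noteq> 0" using quad dist by auto
    have ne: "N \<noteq> 0" "M \<noteq> 0" using y dist by (auto simp: N_def M_def)
    have "(N + M) * (- N * a + M * d) - (- N * a - M * d) * (N - M) = 2 * N * M * (d - a)"
      by algebra
    also have "\<dots> \<noteq> 0" using ne dist by auto
    finally have m: "is_moebius h" unfolding is_moebius_def using R tp by blast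
    have a: "(N - M) * a + (- N * a + M * d) = M * (d - a)" by algebra
    have d: "(N - M) * d + (- N * a + M * d) = N * (d - a)" by algebra
    have b: "(N - M) * b + (- N * a + M * d) = 2 * (b - a) * (b - d)"
      unfolding N_def M_def by algebra
    \<comment> \<open>The factor \<open>y - 1\<close> lets \<open>quad\<close> replace
      \<open>(y - 1) * M * (c - d)\<close> by \<open>(y + 1) * N * (c - a)\<close>, so that
      denominator and numerator at \<open>c\<close> both become multiples of
      \<open>N * (c - a)\<close>.\<close>
    have c: "(y - 1) * ((N - M) * c + (- N * a + M * d)) = - 2 * N * (c - a)"
      using quad unfolding N_def M_def by algebra
    have c': "(y - 1) * ((N + M) * c + (- N * a - M * d)) = 2 * y * N * (c - a)"
      using quad unfolding N_def M_def by algebra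
    have cne: "(N - M) * c + (- N * a + M * d) \<noteq> 0" using c ne dist by auto
    have ceq: "(N + M) * c + (- N * a - M * d) = - y * ((N - M) * c + (- N * a + M * d))"
    proof -
      have "(y - 1) * ((N + M) * c + (- N * a - M * d))
          = (y - 1) * (- y * ((N - M) * c + (- N * a + M * d)))"
        using c c' by algebra
      then show ?thesis by (simp only: mult_left_cancel[OF y(2)])
    qed
    have val: "h (Some z) = Some w"
      if "(N - M) * z + (- N * a + M * d) \<noteq> 0"
        and "(N + M) * z + (- N * a - M * d) = w * ((N - M) * z + (- N * a + M * d))" for z w
      using R that unfolding tp by (metis ext_moebius_Some_eq_Some_iff)
    have "h (Some a) = Some (-1)"
      by (rule val, unfold a) (use ne dist in \<open>auto simp: algebra_simps\<close>)
    moreover have "h (Some b) = Some y"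
    proof (rule val)
      show "(N - M) * b + (- N * a + M * d) \<noteq> 0" unfolding b using dist by auto
      show "(N + M) * b + (- N * a - M * d) = y * ((N - M) * b + (- N * a + M * d))"
        unfolding N_def M_def by algebra
    qed
    moreover have "h (Some c) = Some (- y)"
      by (rule val[OF cne ceq])
    moreover have "h (Some d) = Some 1"
      by (rule val, unfold d) (use ne dist in \<open>auto simp: algebra_simps\<close>)
    ultimately show "normalizes h a b c d y" using m by (simp add: normalizes_def)
  qed
qed

section \<open>The preimage of the origin\<close>

lemma normalizes_inv_0:
  assumes dist: "distinct [a, b, c, d]" and norm: "normalizes h a b c d y"
  shows "inv h (Some 0) =
    (if (b - c) * y + a - d \<noteq> 0
     then Some (((b - c) * (a + d) * y + (b + c) * (a - d)) / (2 * ((b - c) * y + a - d)))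
     else None)"
proof -
  obtain \<alpha> \<beta> \<gamma> \<delta> where nz: "\<alpha> * \<delta> - \<beta> * \<gamma> \<noteq> 0" and h: "h = ext_moebius \<alpha> \<beta> \<gamma> \<delta>"
    and at: "\<alpha> * a + \<beta> = - (\<gamma> * a + \<delta>)" "\<alpha> * b + \<beta> = y * (\<gamma> * b + \<delta>)"
      "\<alpha> * c + \<beta> = - y * (\<gamma> * c + \<delta>)" "\<alpha> * d + \<beta> = \<gamma> * d + \<delta>"
    using norm by (auto simp: normalizes_def is_moebius_def ext_moebius_Some_eq_Some_iff)
  have hy: "h (Some b) = Some y" "h (Some a) = Some (-1)" "h (Some d) = Some 1" "is_moebius h"
    using norm by (auto simp: normalizes_def)
  have "y \<noteq> -1" "y \<noteq> 1"
    using hy is_moebius_bij[OF hy(4)] dist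
    by (metis bij_is_inj distinct_length_2_or_more injD option.inject)+
  then have y: "y\<^sup>2 \<noteq> 1" by (simp add: power2_eq_1_iff)
  define D where "D = (b - c) * y + a - d"
  \<comment> \<open>Adding the conditions at \<open>a, d\<close> and at \<open>b, c\<close> and
    subtracting the sums eliminates \<open>\<beta>\<close>; \<open>minus\<close> similarly takes
    differences within the pairs and eliminates \<open>\<delta>\<close>.\<close>
  have plus: "\<alpha> * (a + d - b - c) = - \<gamma> * D"
    using at unfolding D_def by algebra
  have minus: "- \<gamma> * y * (a + d - b - c) = \<alpha> * (b - c + y * (a - d))"
    using at by algebra
  \<comment> \<open>The preimage of 0 is infinity exactly when \<open>\<alpha> = 0\<close>, so this
    matches the exceptional branch of the formula.\<close>
  have D: "\<alpha> = 0 \<longleftrightarrow> D = 0"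
  proof
    assume "\<alpha> = 0"
    then show "D = 0" using nz plus by auto
  next
    assume "D = 0"
    show "\<alpha> = 0"
    proof (rule ccontr)
      assume "\<alpha> \<noteq> 0"
      then have "b - c + y * (a - d) = 0" using plus minus \<open>D = 0\<close> by simp
      moreover have "a - d = - (b - c) * y"
        using \<open>D = 0\<close> unfolding D_def by algebra
      ultimately have "(b - c) * (1 - y\<^sup>2) = 0" by algebra
      with dist y show False by simp
    qed
  qed
  have inv: "inv h (Some 0) = (if \<alpha> = 0 then None else Some (- \<beta> / \<alpha>))"
    unfolding h inv_ext_moebius[OF nz] by (simp add: ext_moebius_def moebius_def)
  \<comment> \<open>The conditions at \<open>a\<close> and \<open>d\<close> give
    \<open>2 * \<beta> = \<gamma> * (d - a) - \<alpha> * (a + d)\<close>; after multiplication by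
    \<open>D\<close>, \<open>plus\<close> removes \<open>\<gamma>\<close>.\<close>
  have "- \<beta> * (2 * D) = ((b - c) * (a + d) * y + (b + c) * (a - d)) * \<alpha>"
    using at plus unfolding D_def by algebra
  then have "- \<beta> / \<alpha> = ((b - c) * (a + d) * y + (b + c) * (a - d)) / (2 * D)" if "\<alpha> \<noteq> 0"
    using that D frac_eq_eq[of \<alpha> "2 * D" "- \<beta>"] by simp
  with inv D show ?thesis by (simp add: D_def)
qed

section \<open>Collinear segments of equal length, and quadratic roots on the unit circle\<close>

lemma collinear_eq_norm_cases:
  fixes a b c d :: complex
  assumes "collinear {a, b, c, d}" "cmod (a - b) = cmod (c - d)"
  shows "a - b = c - d \<or> a - b = d - c"
proof -
  obtain u where u: "\<And>x y. x \<in> {a, b, c, d} \<Longrightarrow> y \<in> {a, b, c, d} \<Longrightarrow> \<exists>r. x - y = r *\<^sub>R u"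
    using assms(1) unfolding collinear_def by metis
  obtain r s where rs: "a - b = r *\<^sub>R u" "c - d = s *\<^sub>R u"
    using u[of a b] u[of c d] by auto
  then have "u = 0 \<or> \<bar>r\<bar> = \<bar>s\<bar>" using assms(2) by auto
  moreover have "d - c = (- s) *\<^sub>R u" using rs(2) by (simp add: algebra_simps)
  ultimately show ?thesis using rs by (auto simp: abs_eq_iff)
qed

text \<open>Completing the square makes \<open>(y + x)\<^sup>2\<close> real and nonpositive, so
  \<open>y + x\<close> is purely imaginary and the real part of the equation gives the norm.\<close>

lemma self_reciprocal_quadratic_norm:
  fixes x y :: complex
  assumes "y\<^sup>2 + 2 * x * y + 1 = 0" and "x \<in> of_real ` {-1..1}"
  shows "cmod y = 1"
proof -
  obtain r where r: "x = of_real r" "\<bar>r\<bar> \<le> 1" using assms(2) by auto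
  have sq: "(y + of_real r)\<^sup>2 = of_real (r\<^sup>2 - 1)"
    using assms(1) r(1) by simp algebra
  have "r\<^sup>2 \<le> 1" using r(2) by (simp add: abs_square_le_1)
  have im: "(Re y + r) * Im y = 0"
    using arg_cong[OF sq, of Im] by (simp add: power2_eq_square algebra_simps)
  have re: "(Re y + r)\<^sup>2 - (Im y)\<^sup>2 = r\<^sup>2 - 1"
    using arg_cong[OF sq, of Re] by (simp add: power2_eq_square algebra_simps)
  have "Re y + r = 0"
  proof (rule ccontr)
    assume *: "Re y + r \<noteq> 0"
    then have "(Re y + r)\<^sup>2 = r\<^sup>2 - 1" using im re by simp
    moreover have "(Re y + r)\<^sup>2 > 0" using * by simp
    ultimately show False using \<open>r\<^sup>2 \<le> 1\<close> by linarith
  qed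
  then have "Re y = - r" by simp
  then have "(Re y)\<^sup>2 + (Im y)\<^sup>2 = 1" using re by simp
  then show ?thesis by (simp add: cmod_def)
qed

lemma self_reciprocal_quadratic_root_in_disc_iff:
  fixes x y1 y2 :: complex
  assumes prod: "y1 * y2 = 1" and sum: "y1 + y2 = - 2 * x"
  shows "(\<exists>y \<in> {y1, y2}. cmod y < 1) \<longleftrightarrow> x \<notin> of_real ` {-1..1}"
proof
  assume "\<exists>y \<in> {y1, y2}. cmod y < 1"
  then obtain y where y: "y = y1 \<or> y = y2" "cmod y < 1" by blast
  have "y\<^sup>2 + 2 * x * y + 1 = 0" 
  proof -
    have x: "2 * x = - (y1 + y2)" using sum by simp
    have "y\<^sup>2 + 2 * x * y + 1 = y\<^sup>2 - (y1 + y2) * y + y1 * y2"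
      by (simp only: x prod) algebra
    also have "\<dots> = (y - y1) * (y - y2)" by algebra
    finally show ?thesis using y(1) by auto
  qed
  then show "x \<notin> of_real ` {-1..1}" using self_reciprocal_quadratic_norm y(2) by force
next
  assume x: "x \<notin> of_real ` {-1..1}"
  show "\<exists>y \<in> {y1, y2}. cmod y < 1"
  proof (rule ccontr)
    assume "\<not> ?thesis"
    then have ge: "cmod y1 \<ge> 1" "cmod y2 \<ge> 1" by auto
    have "cmod y1 * cmod y2 = 1" using prod by (metis norm_mult norm_one)
    then have "cmod y1 \<le> 1"
      using ge mult_left_mono[of 1 "cmod y2" "cmod y1"] by simp
    then have n: "cmod y1 = 1" using ge by simp
    \<comment> \<open>On the unit circle the reciprocal is the conjugate, so the sum of the roots is
      \<open>2 * Re y1\<close>.\<close>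
    have "y1 * cnj y1 = 1" using n by (simp add: complex_norm_square[symmetric])
    then have "y1 * (y2 - cnj y1) = 0" using prod by (simp add: algebra_simps)
    then have "y2 = cnj y1" using n by auto
    then have "x = of_real (- Re y1)" using sum by (simp add: complex_eq_iff)
    moreover have "\<bar>Re y1\<bar> \<le> 1" using abs_Re_le_cmod[of y1] n by simp
    ultimately show False using x by (auto simp: abs_le_iff intro: rev_image_eqI)
  qed
qed

section \<open>The collinear parallelogram case and the general case\<close>

theorem theorem1p1:
  fixes a b c d k0 k1 y1 y2 :: complex
  assumes "distinct [a, b, c, d]"
    and "k0 = (b - c) * (a - d)"
    and "k1 = (a - c) * (b - d) + (a - b) * (c - d)"
    and "y1 = (- k1 + csqrt (k1\<^sup>2 - k0\<^sup>2)) / k0"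
    and "y2 = (- k1 - csqrt (k1\<^sup>2 - k0\<^sup>2)) / k0"
  shows
    "if collinear {a, b, c, d} \<and> cmod (a - b) = cmod (c - d) \<and> a - b \<noteq> d - c
     then (\<exists>y h. normalizes h a b c d y \<and> (b - c) * y + a - d \<noteq> 0) \<and>
          (\<forall>y h. normalizes h a b c d y \<longrightarrow>
             inv h (Some 0) =
               (if (b - c) * y + a - d \<noteq> 0 then Some ((a + d) / 2) else None))
     else (\<forall>y h. normalizes h a b c d y \<longrightarrow>
             (y = y1 \<or> y = y2) \<and>
             inv h (Some 0) =
               (if (b - c) * y + a - d \<noteq> 0
                then Some (((b - c) * (a + d) * y + (b + c) * (a - d))
                             / (2 * ((b - c) * y + a - d)))
                else None)) \<and>
          (\<forall>y \<in> {y1, y2}. \<exists>!h. normalizes h a b c d y) \<and>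
          y1 * y2 = 1 \<and>
          ((\<exists>y \<in> {y1, y2}. cmod y < 1) \<longleftrightarrow> k1 / k0 \<notin> of_real ` {-1..1})"
proof -
  note dist = assms(1)
  have k0: "k0 \<noteq> 0" using assms(1,2) by auto
  define w where "w = csqrt (k1\<^sup>2 - k0\<^sup>2)"
  have w: "w\<^sup>2 = k1\<^sup>2 - k0\<^sup>2" by (simp add: w_def)
  have y12: "k0 * y1 = - k1 + w" "k0 * y2 = - k1 - w"
    using k0 assms(4,5) by (simp_all add: w_def)
  have iff: "normalizes h a b c d y \<longleftrightarrow>
      h = three_point_moebius a b d y \<and> k0 * y\<^sup>2 + 2 * k1 * y + k0 = 0" for h y
    using normalizes_iff[OF dist, of h y] assms(2,3) by simp
  show ?thesis
  \<comment> \<open>The pattern \<open>_ \<longrightarrow> _\<close> restricts \<open>conjI\<close>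
    to the outer conjunction, leaving each branch whole.\<close>
  proof (split if_split, intro conjI[of "_ \<longrightarrow> _"] impI)
    assume C: "collinear {a, b, c, d} \<and> cmod (a - b) = cmod (c - d) \<and> a - b \<noteq> d - c"
    then have "a - b = c - d" using collinear_eq_norm_cases by blast
    then have mid: "d = b + c - a" by algebra
    \<comment> \<open>The reciprocal of \<open>- (a - d) / (b - c)\<close>, the value at which
      \<open>(b - c) * y + a - d\<close> vanishes.\<close>
    define y where "y = - (b - c) / (a - d)"
    have y: "(a - d) * y = - (b - c)" using dist by (simp add: y_def)
    have "(a - d) * (k0 * y\<^sup>2 + 2 * k1 * y + k0) = 0"
      using y mid assms(2,3) by algebra
    then have quad: "k0 * y\<^sup>2 + 2 * k1 * y + k0 = 0" using dist by simp
    have "(a - d) * ((b - c) * y + a - d) = 4 * (a - c) * (a - b)"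
      using y mid by algebra
    then have "(b - c) * y + a - d \<noteq> 0" using dist by auto
    then have ex: "\<exists>y h. normalizes h a b c d y \<and> (b - c) * y + a - d \<noteq> 0"
      using iff quad by blast
    have "inv h (Some 0) = (if (b - c) * y + a - d \<noteq> 0 then Some ((a + d) / 2) else None)"
      if "normalizes h a b c d y" for y h
    proof -
      \<comment> \<open>Here \<open>b + c = a + d\<close>: the segments \<open>ad\<close> and
        \<open>bc\<close> share their midpoint, and \<open>a + d\<close> factors out.\<close>
      have num: "(b - c) * (a + d) * y + (b + c) * (a - d) = (a + d) * ((b - c) * y + a - d)"
        using mid by algebra
      have frac: "(a + d) * E / (2 * E) = (a + d) / 2" if "E \<noteq> 0" for E
        using that by simp
      show ?thesis
        unfolding normalizes_inv_0[OF dist that] num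
        by (simp only: frac not_False_eq_True cong: if_cong)
    qed
    with ex show "(\<exists>y h. normalizes h a b c d y \<and> (b - c) * y + a - d \<noteq> 0) \<and>
        (\<forall>y h. normalizes h a b c d y \<longrightarrow> inv h (Some 0) =
          (if (b - c) * y + a - d \<noteq> 0 then Some ((a + d) / 2) else None))"
      by blast
  next
    have roots: "k0 * y\<^sup>2 + 2 * k1 * y + k0 = 0 \<longleftrightarrow> y = y1 \<or> y = y2" for y
    proof -
      \<comment> \<open>Multiplied by \<open>k0\<close>, the quadratic is
        \<open>(k0 * y + k1)\<^sup>2 - w\<^sup>2\<close>, a difference of squares.\<close>
      have "k0 * (k0 * y\<^sup>2 + 2 * k1 * y + k0) = (k0 * y - k0 * y1) * (k0 * y - k0 * y2)"
        using w y12 by algebra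
      then show ?thesis using k0 by auto
    qed
    have "k0\<^sup>2 * (y1 * y2) = k0\<^sup>2 * 1" using w y12 by algebra
    then have prod: "y1 * y2 = 1" using k0 by simp
    have "k0 * (y1 + y2) = - 2 * k1" using y12 by algebra
    then have "y1 + y2 = - 2 * (k1 / k0)" using k0 by (simp add: field_simps)
    note disc = self_reciprocal_quadratic_root_in_disc_iff[OF prod this]
    show "(\<forall>y h. normalizes h a b c d y \<longrightarrow>
             (y = y1 \<or> y = y2) \<and>
             inv h (Some 0) =
               (if (b - c) * y + a - d \<noteq> 0
                then Some (((b - c) * (a + d) * y + (b + c) * (a - d))
                             / (2 * ((b - c) * y + a - d)))
                else None)) \<and>
          (\<forall>y \<in> {y1, y2}. \<exists>!h. normalizes h a b c d y) \<and>
          y1 * y2 = 1 \<and>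
          ((\<exists>y \<in> {y1, y2}. cmod y < 1) \<longleftrightarrow> k1 / k0 \<notin> of_real ` {-1..1})"
    proof (intro conjI)
      show "\<forall>y h. normalizes h a b c d y \<longrightarrow>
             (y = y1 \<or> y = y2) \<and>
             inv h (Some 0) =
               (if (b - c) * y + a - d \<noteq> 0
                then Some (((b - c) * (a + d) * y + (b + c) * (a - d))
                             / (2 * ((b - c) * y + a - d)))
                else None)"
        using normalizes_inv_0[OF dist] iff roots by blast
      show "\<forall>y \<in> {y1, y2}. \<exists>!h. normalizes h a b c d y"
        using iff roots by auto
    qed (use prod disc in blast)+
  qed
qed

end
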